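(* Let $k, q$ be integers with $1 \leq k \leq q$, let $I$ be the $q \times q$ identity matrix with columns $e_1, \ldots, e_q$, and let $B = [e_1, \ldots, e_k] \in \mathbb{R}^{q \times k}$. Then the minimum of $\lVert I - BA \rVert^2$ over all column stochastic matrices $A \in \mathbb{R}^{k \times q}$ is $$(q-k) \cdot \frac{k+1}{k}.$$
   Context: All matrices are real and $\lVert M \rVert$ denotes the Frobenius norm, $\lVert M \rVert^2 = \sum_{i,j} m_{ij}^2$. A matrix is column stochastic if each of its columns has nonnegative entries summing to $1$. *)

theory Defs
  imports Complex_Main "Jordan_Normal_Form.Matrix"
begin

definition frobenius_norm :: "real mat \<Rightarrow> real" where
  "frobenius_norm M = sqrt (\<Sum>i<dim_row M. \<Sum>j<dim_col M. (M $$ (i, j))\<^sup>2)"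

definition column_stochastic :: "real mat \<Rightarrow> bool" where
  "column_stochastic A \<longleftrightarrow>
     (\<forall>j<dim_col A. (\<forall>i<dim_row A. 0 \<le> A $$ (i, j)) \<and> (\<Sum>i<dim_row A. A $$ (i, j)) = 1)"

end

theory Submission
  imports Defs
begin

text \<open>
  Left multiplication by \<open>B\<close> pads a \<open>k \<times> q\<close> matrix \<open>A\<close> with \<open>q - k\<close> zero rows, so the squared
  distance from \<open>I\<close> to \<open>B A\<close> splits over the columns, which can be chosen independently
  (lemma \<open>frobenius_residual\<close>). A column \<open>j < k\<close> contributes the squared distance from \<open>e\<^sub>j\<close> to a
  probability vector in \<open>\<real>\<^sup>k\<close>; its minimum is \<open>0\<close>, attained at \<open>e\<^sub>j\<close>. In a column \<open>j \<ge> k\<close> the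
  diagonal entry of \<open>I\<close> lies in a padded row and costs \<open>1\<close>, and the rest is the squared length of a
  probability vector in \<open>\<real>\<^sup>k\<close>, which is at least \<open>1 / k\<close> with equality for the uniform one
  (lemma \<open>sum_squares_ge_inverse\<close>). Adding \<open>q - k\<close> copies of \<open>1 + 1 / k\<close> gives the minimum.
\<close>

lemma sum_lessThan_split:
  fixes f :: "nat \<Rightarrow> 'a::comm_monoid_add"
  assumes "k \<le> q"
  shows "sum f {..<q} = sum f {..<k} + sum f {k..<q}"
  using assms by (metis sum.atLeastLessThan_concat lessThan_atLeast0 le0)

text \<open>The difference of the two sides is the squared distance from \<open>a\<close> to the uniform vector
  \<open>(1 / k, \<dots>, 1 / k)\<close>.\<close>

lemma sum_squares_ge_inverse:
  fixes a :: "nat \<Rightarrow> real"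
  assumes "1 \<le> k" and "(\<Sum>i<k. a i) = 1"
  shows "1 / real k \<le> (\<Sum>i<k. (a i)\<^sup>2)"
proof -
  have "0 \<le> (\<Sum>i<k. (a i - 1 / real k)\<^sup>2)"
    by (simp add: sum_nonneg)
  also have "\<dots> = (\<Sum>i<k. (a i)\<^sup>2) - 2 / real k * (\<Sum>i<k. a i) + real k * (1 / real k)\<^sup>2"
    by (simp add: power2_diff sum.distrib sum_subtractf sum_distrib_left
        sum_divide_distrib algebra_simps)
  also have "\<dots> = (\<Sum>i<k. (a i)\<^sup>2) - 1 / real k"
    using assms by (simp add: power2_eq_square field_simps)
  finally show ?thesis by simp
qed

lemma unit_cols_times_index:
  fixes A :: "real mat"
  assumes "k \<le> q" and A: "A \<in> carrier_mat k q" and "i < q" and "j < q"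
  shows "(mat_of_cols q (map (col (1\<^sub>m q)) [0..<k]) * A) $$ (i, j)
           = (if i < k then A $$ (i, j) else 0)"
proof -
  have "(mat_of_cols q (map (col (1\<^sub>m q)) [0..<k]) * A) $$ (i, j)
          = (\<Sum>l = 0..<k. (if i = l then 1 else 0) * A $$ (l, j))"
    using assms by (auto simp: scalar_prod_def mat_of_cols_index intro!: sum.cong)
  also have "\<dots> = (if i < k then A $$ (i, j) else 0)"
    by (simp add: if_distrib[of "\<lambda>x. x * _"] sum.delta cong: if_cong)
  finally show ?thesis .
qed

lemma frobenius_residual:
  fixes A :: "real mat"
  assumes kq: "k \<le> q" and A: "A \<in> carrier_mat k q"
  shows "(frobenius_norm (1\<^sub>m q - mat_of_cols q (map (col (1\<^sub>m q)) [0..<k]) * A))\<^sup>2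
           = (\<Sum>j<k. \<Sum>i<k. ((if i = j then 1 else 0) - A $$ (i, j))\<^sup>2)
             + (\<Sum>j = k..<q. 1 + (\<Sum>i<k. (A $$ (i, j))\<^sup>2))"
proof -
  let ?B = "mat_of_cols q (map (col (1\<^sub>m q)) [0..<k]) :: real mat"
  let ?r = "\<lambda>i j. ((if i = j then 1 else 0) - (if i < k then A $$ (i, j) else 0))\<^sup>2"
  have "(frobenius_norm (1\<^sub>m q - ?B * A))\<^sup>2
          = (\<Sum>i<q. \<Sum>j<q. ((1\<^sub>m q - ?B * A) $$ (i, j))\<^sup>2)"
    using A by (simp add: frobenius_norm_def sum_nonneg)
  also have "\<dots> = (\<Sum>i<q. \<Sum>j<q. ?r i j)"
  proof (intro sum.cong refl)
    fix i j assume "i \<in> {..<q}" and "j \<in> {..<q}"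
    then show "((1\<^sub>m q - ?B * A) $$ (i, j))\<^sup>2 = ?r i j"
      using A unit_cols_times_index[OF kq A, of i j] by (simp del: index_mult_mat(1))
  qed
  also have "\<dots> = (\<Sum>j<q. (\<Sum>i<k. ?r i j) + (\<Sum>i = k..<q. ?r i j))"
    by (subst sum.swap) (simp only: sum_lessThan_split[OF kq])
  also have "\<dots> = (\<Sum>j<k. (\<Sum>i<k. ?r i j) + (\<Sum>i = k..<q. ?r i j))
                  + (\<Sum>j = k..<q. (\<Sum>i<k. ?r i j) + (\<Sum>i = k..<q. ?r i j))"
    by (rule sum_lessThan_split[OF kq])
  also have "(\<Sum>j<k. (\<Sum>i<k. ?r i j) + (\<Sum>i = k..<q. ?r i j))
               = (\<Sum>j<k. \<Sum>i<k. ((if i = j then 1 else 0) - A $$ (i, j))\<^sup>2)"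
    by (intro sum.cong refl) simp
  also have "(\<Sum>j = k..<q. (\<Sum>i<k. ?r i j) + (\<Sum>i = k..<q. ?r i j))
               = (\<Sum>j = k..<q. 1 + (\<Sum>i<k. (A $$ (i, j))\<^sup>2))"
  proof (intro sum.cong refl)
    fix j assume j: "j \<in> {k..<q}"
    have "(\<Sum>i = k..<q. ?r i j) = (\<Sum>i = k..<q. if i = j then 1 else 0)"
      by (intro sum.cong refl) auto
    also have "\<dots> = 1"
      using j by simp
    finally have "(\<Sum>i = k..<q. ?r i j) = 1" .
    moreover have "(\<Sum>i<k. ?r i j) = (\<Sum>i<k. (A $$ (i, j))\<^sup>2)"
      using j by (intro sum.cong refl) auto
    ultimately show "(\<Sum>i<k. ?r i j) + (\<Sum>i = k..<q. ?r i j)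
                       = 1 + (\<Sum>i<k. (A $$ (i, j))\<^sup>2)"
      by linarith
  qed
  finally show ?thesis .
qed

theorem mainTheorem4:
  fixes k q :: nat and B :: "real mat"
  assumes "1 \<le> k" and "k \<le> q"
    and "B = mat_of_cols q (map (col (1\<^sub>m q)) [0..<k])"
  shows "(\<exists>A \<in> carrier_mat k q. column_stochastic A \<and>
            (frobenius_norm (1\<^sub>m q - B * A))\<^sup>2 = (real q - real k) * ((real k + 1) / real k))
       \<and> (\<forall>A \<in> carrier_mat k q. column_stochastic A \<longrightarrow>
            (real q - real k) * ((real k + 1) / real k) \<le> (frobenius_norm (1\<^sub>m q - B * A))\<^sup>2)"
proof -
  have value_eq: "(\<Sum>j = k..<q. 1 + 1 / real k) = (real q - real k) * ((real k + 1) / real k)"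
    using assms(1,2) by (simp add: of_nat_diff field_simps)
  define A0 :: "real mat" where
    "A0 = mat k q (\<lambda>(i, j). if j < k then (if i = j then 1 else 0) else 1 / real k)"
  have A0: "A0 \<in> carrier_mat k q"
    by (simp add: A0_def)
  have "column_stochastic A0"
    unfolding column_stochastic_def
  proof (intro allI impI conjI)
    fix j assume "j < dim_col A0"
    then show "(\<Sum>i<dim_row A0. A0 $$ (i, j)) = 1"
      using assms(1) by (cases "j < k") (simp_all add: A0_def)
  qed (auto simp: A0_def)
  moreover have "(frobenius_norm (1\<^sub>m q - B * A0))\<^sup>2
                   = (real q - real k) * ((real k + 1) / real k)"
  proof -
    have "(\<Sum>j<k. \<Sum>i<k. ((if i = j then 1 else 0) - A0 $$ (i, j))\<^sup>2) = 0"
      using assms(2) by (intro sum.neutral ballI) (auto simp: A0_def)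
    moreover have "(\<Sum>j = k..<q. 1 + (\<Sum>i<k. (A0 $$ (i, j))\<^sup>2)) = (\<Sum>j = k..<q. 1 + 1 / real k)"
      using assms(1) by (intro sum.cong refl) (simp add: A0_def power2_eq_square)
    ultimately show ?thesis
      using frobenius_residual[OF assms(2) A0] value_eq assms(3) by simp
  qed
  moreover have "(real q - real k) * ((real k + 1) / real k) \<le> (frobenius_norm (1\<^sub>m q - B * A))\<^sup>2"
    if A: "A \<in> carrier_mat k q" and st: "column_stochastic A" for A
  proof -
    have "(\<Sum>j = k..<q. 1 + 1 / real k) \<le> (\<Sum>j = k..<q. 1 + (\<Sum>i<k. (A $$ (i, j))\<^sup>2))"
    proof (intro sum_mono add_left_mono)
      fix j assume "j \<in> {k..<q}"
      then have "(\<Sum>i<k. A $$ (i, j)) = 1"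
        using A st by (auto simp: column_stochastic_def)
      then show "1 / real k \<le> (\<Sum>i<k. (A $$ (i, j))\<^sup>2)"
        by (rule sum_squares_ge_inverse[OF assms(1)])
    qed
    moreover have "0 \<le> (\<Sum>j<k. \<Sum>i<k. ((if i = j then 1 else 0) - A $$ (i, j))\<^sup>2)"
      by (intro sum_nonneg) simp
    ultimately show ?thesis
      unfolding assms(3) frobenius_residual[OF assms(2) A] value_eq[symmetric] by linarith
  qed
  ultimately show ?thesis
    using A0 by blast
qed

end
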